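(* Let $f\colon \mathbb{N}\rightarrow \mathbb{N}$ be a non-decreasing, unbounded, submultiplicative function. Then there exists a minimal subshift $\mathcal{X}$ (over some finite alphabet) such that $f(n) \preceq p_{\mathcal{X}}(n) \preceq n f(n)$.
   Context: A function $f\colon\mathbb{N}\to\mathbb{N}$ is submultiplicative if $f(n+m)\leq f(n)f(m)$ for all $n,m\in\mathbb{N}$. Let $\Sigma$ be a finite alphabet. A subshift over $\Sigma$ is a non-empty closed subset $\mathcal{X}\subseteq\Sigma^{\mathbb{N}}$ (product topology) that is invariant under the shift $T(w_0w_1w_2\cdots)=w_1w_2w_3\cdots$. A subshift is minimal if it contains no proper subshift. The complexity function $p_{\mathcal{X}}(n)$ is the number of words $u\in\Sigma^n$ that occur as a factor (contiguous subword) of some $w\in\mathcal{X}$. For non-decreasing functions $f,g\colon\mathbb{N}\to\mathbb{N}$, write $f\preceq g$ (also written $f(n)\preceq g(n)$) if there are constants $C,D>0$ such that $f(n)\leq C g(Dn)$ for all $n\geq 1$ (as $g$ is non-decreasing, $D$ may be taken to be a positive integer). Here $nf(n)$ denotes the function $n\mapsto n\cdot f(n)$. *)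

theory Defs
  imports "HOL-Analysis.Analysis"
begin

definition submultiplicative :: "(nat \<Rightarrow> nat) \<Rightarrow> bool" where
  "submultiplicative f \<longleftrightarrow> (\<forall>n m. f (n + m) \<le> f n * f m)"

definition shift :: "(nat \<Rightarrow> 'a) \<Rightarrow> nat \<Rightarrow> 'a" where
  "shift w = (\<lambda>i. w (Suc i))"

(* The set "A" is the alphabet; the ambient space is the full one-sided shift over A,
   so being closed in it already entails that every sequence in X has letters in A.
   Invariance means T(X) is a subset of X. *)
definition subshift :: "'a set \<Rightarrow> (nat \<Rightarrow> 'a) set \<Rightarrow> bool" where
  "subshift A X \<longleftrightarrow>
     X \<noteq> {} \<and>
     closedin (product_topology (\<lambda>_. discrete_topology A) UNIV) X \<and>
     shift ` X \<subseteq> X"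

definition minimal_subshift :: "'a set \<Rightarrow> (nat \<Rightarrow> 'a) set \<Rightarrow> bool" where
  "minimal_subshift A X \<longleftrightarrow> subshift A X \<and> \<not> (\<exists>Y. subshift A Y \<and> Y \<subset> X)"

definition occurs_in :: "'a list \<Rightarrow> (nat \<Rightarrow> 'a) \<Rightarrow> bool" where
  "occurs_in u w \<longleftrightarrow> (\<exists>i. u = map w [i..<i + length u])"

definition complexity :: "(nat \<Rightarrow> 'a) set \<Rightarrow> nat \<Rightarrow> nat" where
  "complexity X n = card {u. length u = n \<and> (\<exists>w\<in>X. occurs_in u w)}"

(* Intended for non-decreasing functions, where restricting D to positive
   integers loses nothing. *)
definition dominated :: "(nat \<Rightarrow> nat) \<Rightarrow> (nat \<Rightarrow> nat) \<Rightarrow> bool"  (infix \<open>\<preceq>\<close> 50) where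
  "f \<preceq> g \<longleftrightarrow>
     (\<exists>C::real. \<exists>D::nat. C > 0 \<and> D > 0 \<and> (\<forall>n\<ge>1. real (f n) \<le> C * real (g (D * n))))"

end

theory Submission
  imports Defs "HOL-Library.Sublist" "HOL-Library.Countable"
begin

text \<open>
  Put \<open>F k = f (2 ^ k)\<close>. The subshift consists of the sequences all of whose factors are factors of
  words from sets \<open>W k\<close> of blocks, where the blocks of \<open>W k\<close> have a common length \<open>l k\<close> with
  \<open>2 ^ k \<le> l k \<le> 2 * 2 ^ k\<close> and their number lies between \<open>F k\<close> and \<open>2 * F k\<close>. A block of \<open>W (k + 1)\<close>
  is a block of \<open>W k\<close>, then possibly a short fixed word, then a block from a subset \<open>C k\<close> of \<open>W k\<close>.
  Submultiplicativity says \<open>F (k + 1) \<le> F k * F k\<close>, which is exactly what allows the size of \<open>C k\<close> to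
  be chosen so that \<open>W (k + 1)\<close> again has about \<open>F (k + 1)\<close> elements (\<open>branching_number\<close>).

  The lower bound is immediate, as every block of \<open>W k\<close> is a factor (\<open>complexity_ge\<close>). For the upper
  bound, cut a sequence of the subshift into blocks of \<open>W k\<close>. Of two neighbouring blocks, at least one
  lies in \<open>C k\<close>, so there are at most \<open>2 * card (W k) * card (C k) = 2 * card (W (k + 1))\<close> pairs of
  neighbours. A factor of length at most \<open>l k\<close> meets at most two neighbours and the word between them,
  so that apart from its position, which accounts for the factor \<open>n\<close> of the bound, there are
  about \<open>F (k + 1)\<close> possibilities (\<open>complexity_le\<close>).

  Concatenation alone need not give a minimal subshift: for \<open>f n = 2 ^ n\<close> it gives the full shift.
  The inserted words force minimality. At every stage one word \<open>v k\<close> waits, which is empty at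
  first and later a block of stage at most \<open>k\<close>. It is inserted between the two halves of all new blocks as soon as it is so short in
  comparison with them that the lengths still grow like \<open>2 ^ k\<close>, and a new waiting word is then
  chosen among the blocks just formed. The choices follow an enumeration of all words in which each
  word recurs infinitely often, so every block is at some point contained in an inserted word, hence
  in all blocks of some later stage; this gives minimality (\<open>minimal_blocks_shift\<close>). Since only one
  word waits at a time, every word inserted from stage \<open>k\<close> on is either \<open>v k\<close> or a block formed later
  than stage \<open>k\<close>, which itself decomposes into blocks of \<open>W k\<close>. Thus only the single word \<open>v k\<close> can
  separate two blocks of \<open>W k\<close>, and the insertions cost no more than a constant factor in the count.
\<close>

section \<open>Factors of sequences\<close>

lemma sublist_imp_occurs_in:
  assumes "sublist u (map x [i..<j])"
  shows "occurs_in u x"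
proof -
  obtain p q where pq: "map x [i..<j] = p @ u @ q"
    using assms by (auto simp: sublist_def)
  have len: "length p + length u + length q = j - i"
    using arg_cong[OF pq, of length] by simp
  have "u = map x [i + length p..<i + length p + length u]"
  proof (cases "u = []")
    case False
    then have "i + length p + length u \<le> j" using len by (cases u) simp_all
    then have "take (length u) (drop (length p) (map x [i..<j])) =
        map x [i + length p..<i + length p + length u]"
      by (simp add: take_map drop_map drop_upt take_upt)
    then show ?thesis using pq by simp
  qed simp
  then show ?thesis
    unfolding occurs_in_def by blast
qed

lemma occurs_in_imp_sublist_prefix:
  assumes "occurs_in u x"
  obtains n where "sublist u (map x [0..<n])"
proof -
  obtain i where "u = map x [i..<i + length u]"
    using assms by (auto simp: occurs_in_def)
  moreover have "[0..<i + length u] = [0..<i] @ [i..<i + length u]"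
    using upt_add_eq_append[of 0 i "length u"] by simp
  ultimately have "map x [0..<i + length u] = map x [0..<i] @ u"
    by (metis map_append)
  then have "sublist u (map x [0..<i + length u])"
    by (metis sublist_appendI append_Nil2)
  then show ?thesis by (rule that)
qed

text \<open>A neighbourhood of a sequence constrains finitely many coordinates, so closedness means
  containing every sequence whose prefixes all begin elements of the set.\<close>
lemma closedin_sequences_iff:
  fixes A :: "'a set"
  shows "closedin (product_topology (\<lambda>_. discrete_topology A) UNIV) X \<longleftrightarrow>
    X \<subseteq> {x. \<forall>i::nat. x i \<in> A} \<and>
    (\<forall>x. (\<forall>i. x i \<in> A) \<longrightarrow> (\<forall>n. \<exists>y\<in>X. \<forall>i<n. y i = x i) \<longrightarrow> x \<in> X)"
    (is "closedin ?T X \<longleftrightarrow> ?sub \<and> ?lim")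
proof -
  have top: "topspace ?T = {x. \<forall>i. x i \<in> A}"
    by (auto simp: PiE_def Pi_def)
  show ?thesis
  proof (intro iffI conjI)
    assume cl: "closedin ?T X"
    show ?sub using closedin_subset[OF cl] top by simp
    show ?lim
    proof (intro allI impI, rule ccontr)
      fix x assume xA: "\<forall>i. x i \<in> A" and ap: "\<forall>n. \<exists>y\<in>X. \<forall>i<n. y i = x i" and "x \<notin> X"
      have "openin ?T (topspace ?T - X)" using cl by (simp add: closedin_def)
      moreover have "x \<in> topspace ?T - X" using xA \<open>x \<notin> X\<close> top by simp
      ultimately have "\<exists>U. finite {i \<in> UNIV. U i \<noteq> topspace (discrete_topology A)} \<and>
         (\<forall>i\<in>UNIV. openin (discrete_topology A) (U i)) \<and> x \<in> PiE UNIV U \<and>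
         PiE UNIV U \<subseteq> topspace ?T - X"
        unfolding openin_product_topology_alt by (rule bspec)
      then obtain U where "finite {i \<in> UNIV. U i \<noteq> topspace (discrete_topology A)}"
        and xU: "x \<in> PiE UNIV U" and US: "PiE UNIV U \<subseteq> topspace ?T - X"
        by (elim exE conjE)
      then have fin: "finite {i. U i \<noteq> A}" by simp
      obtain n where n: "\<And>i. U i \<noteq> A \<Longrightarrow> i < n"
        using fin finite_nat_set_iff_bounded by auto
      obtain y where y: "y \<in> X" "\<And>i. i < n \<Longrightarrow> y i = x i" using ap by blast
      have "y i \<in> U i" for i
      proof (cases "i < n")
        case True then show ?thesis using y xU by (auto simp: PiE_def Pi_def)
      next
        case False
        then have "U i = A" using n by blast
        then show ?thesis using y(1) closedin_subset[OF cl] top by auto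
      qed
      then have "y \<in> PiE UNIV U" by (auto simp: PiE_def Pi_def)
      then show False using US y(1) by blast
    qed
  next
    assume *: "?sub \<and> ?lim"
    have "openin ?T (topspace ?T - X)"
      unfolding openin_product_topology_alt
    proof (intro ballI)
      fix x assume x: "x \<in> topspace ?T - X"
      then have xA: "\<forall>i. x i \<in> A" and "x \<notin> X" using top by auto
      then have "\<not> (\<forall>n. \<exists>y\<in>X. \<forall>i<n. y i = x i)"
        using conjunct2[OF *, THEN spec, of x] by metis
      then obtain n where n: "\<And>y. y \<in> X \<Longrightarrow> \<exists>i<n. y i \<noteq> x i" by blast
      define U where "U i = (if i < n then {x i} else A)" for i
      have "finite {i. U i \<noteq> topspace (discrete_topology A)}"
        by (rule finite_subset[of _ "{..<n}"]) (auto simp: U_def)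
      moreover have "\<forall>i. openin (discrete_topology A) (U i)" using xA by (auto simp: U_def)
      moreover have "x \<in> PiE UNIV U" using xA by (auto simp: U_def)
      moreover have "PiE UNIV U \<subseteq> topspace ?T - X"
      proof
        fix y assume "y \<in> PiE UNIV U"
        then have yU: "\<And>i. y i \<in> U i" by auto
        have "y i \<in> A" for i using yU[of i] xA by (auto simp: U_def split: if_splits)
        moreover have "y i = x i" if "i < n" for i using yU[of i] that by (simp add: U_def)
        ultimately have "y \<notin> X" "\<forall>i. y i \<in> A" using n[of y] by blast+
        then show "y \<in> topspace ?T - X" unfolding top by simp
      qed
      ultimately show "\<exists>U. finite {i \<in> UNIV. U i \<noteq> topspace (discrete_topology A)} \<and>
         (\<forall>i\<in>UNIV. openin (discrete_topology A) (U i)) \<and> x \<in> PiE UNIV U \<and>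
         PiE UNIV U \<subseteq> topspace ?T - X" by auto
    qed
    then show "closedin ?T X" using * top by (simp add: closedin_def)
  qed
qed

lemma subshift_tail:
  assumes "subshift A X" "x \<in> X"
  shows "(\<lambda>i. x (j + i)) \<in> X"
proof (induction j)
  case 0 then show ?case using assms by simp
next
  case (Suc j)
  then have "shift (\<lambda>i. x (j + i)) \<in> X" using assms by (auto simp: subshift_def)
  then show ?case by (simp add: shift_def)
qed

text \<open>Used with \<open>b\<close> and \<open>c\<close> the neighbouring blocks at the junction of two block decompositions. A
  factor that lies on neither side of the junction swallows one of these blocks or fits into
  \<open>b @ t @ c\<close>. This serves both extremes: short factors, which are too
  short to swallow a block, and long ones, which do not fit into \<open>b @ t @ c\<close>.\<close>
lemma sublist_across_gap:
  assumes "sublist u (x @ b @ t @ c @ y)"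
  shows "sublist u (x @ b) \<or> sublist u (c @ y) \<or> sublist b u \<or> sublist c u \<or> sublist u (b @ t @ c)"
proof -
  obtain p q where pq: "x @ b @ t @ c @ y = p @ u @ q" using assms by (auto simp: sublist_def)
  have "prefix p (x @ b @ t @ c @ y)" using pq by simp
  have "suffix q (x @ b @ t @ c @ y)" using pq by (metis append_assoc suffixI)
  consider (1) "length p \<le> length x" "length q \<ge> length t + length c + length y"
    | (2) "length p \<ge> length x + length b + length t"
    | (3) "length p \<le> length x" "length q \<le> length t + length c + length y"
    | (4) "length q \<le> length y" "length p \<le> length x + length b + length t"
    | (5) "length p \<ge> length x" "length q \<ge> length y"
    by linarith
  then show ?thesis
  proof cases
    case 1
    have "suffix (t @ c @ y) q"
      using 1 \<open>suffix q (x @ b @ t @ c @ y)\<close>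
      by (metis append_assoc length_append suffix_length_suffix suffixI add.assoc)
    then obtain q' where "q = q' @ t @ c @ y" by (auto simp: suffix_def)
    then have "x @ b = p @ u @ q'" using pq by simp
    then show ?thesis by (metis sublist_appendI)
  next
    case 2
    have "prefix (x @ b @ t) p"
      using 2 \<open>prefix p (x @ b @ t @ c @ y)\<close>
      by (metis append_assoc length_append prefix_length_prefix prefixI add.assoc)
    then obtain p' where "p = x @ b @ t @ p'" by (auto simp: prefix_def)
    then have "c @ y = p' @ u @ q" using pq by simp
    then show ?thesis by (metis sublist_appendI)
  next
    case 3
    have "prefix p x" using 3 \<open>prefix p (x @ b @ t @ c @ y)\<close> by (metis prefix_length_prefix prefixI)
    moreover have "suffix q (t @ c @ y)"
      using 3 \<open>suffix q (x @ b @ t @ c @ y)\<close>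
      by (metis append_assoc length_append suffix_length_suffix suffixI add.assoc)
    ultimately obtain p' q' where "x = p @ p'" "t @ c @ y = q' @ q"
      by (auto simp: prefix_def suffix_def)
    then have "p @ u @ q = p @ (p' @ b @ q') @ q" using pq by simp
    then have "u = p' @ b @ q'" by simp
    then show ?thesis by (metis sublist_appendI)
  next
    case 4
    have "prefix p (x @ b @ t)"
      using 4 \<open>prefix p (x @ b @ t @ c @ y)\<close>
      by (metis append_assoc length_append prefix_length_prefix prefixI add.assoc)
    moreover have "suffix q y"
      using 4 \<open>suffix q (x @ b @ t @ c @ y)\<close> by (metis append_assoc suffix_length_suffix suffixI)
    ultimately obtain p' q' where "x @ b @ t = p @ p'" "y = q' @ q"
      by (auto simp: prefix_def suffix_def)
    then have "p @ u @ q = p @ (p' @ c @ q') @ q" using pq by (metis append_assoc)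
    then have "u = p' @ c @ q'" by simp
    then show ?thesis by (metis sublist_appendI)
  next
    case 5
    have "prefix x p" using 5 \<open>prefix p (x @ b @ t @ c @ y)\<close> by (metis prefix_length_prefix prefixI)
    moreover have "suffix y q"
      using 5 \<open>suffix q (x @ b @ t @ c @ y)\<close> by (metis append_assoc suffix_length_suffix suffixI)
    ultimately obtain p' q' where "p = x @ p'" "q = q' @ y"
      by (auto simp: prefix_def suffix_def)
    then have "b @ t @ c = p' @ u @ q'" using pq by simp
    then show ?thesis by (metis sublist_appendI)
  qed
qed


section \<open>Subshifts built from nested sets of blocks\<close>

lemma card_joined_blocks:
  assumes "\<And>u. u \<in> W \<Longrightarrow> length u = n"
  shows "card ((\<lambda>(a, b). a @ g @ b) ` (W \<times> C)) = card W * card C"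
proof -
  have "inj_on (\<lambda>(a, b). a @ g @ b) (W \<times> C)"
    by (auto intro!: inj_onI simp: assms)
  then show ?thesis
    by (simp add: card_image card_cartesian_product)
qed

text \<open>
  The word \<open>v k\<close> is the one waiting at stage \<open>k\<close>, and \<open>ins k\<close> says that it is inserted into the
  blocks formed from stage \<open>k\<close>. It is placed in the middle so that every block begins and
  ends with a block of each earlier stage; hence, when a sequence is cut into blocks of stage \<open>k\<close>,
  no two inserted words that remain uncut follow each other directly.
\<close>
locale block_system =
  fixes A :: "'a set" and W C :: "nat \<Rightarrow> 'a list set"
    and v :: "nat \<Rightarrow> 'a list" and ins :: "nat \<Rightarrow> bool" and l :: "nat \<Rightarrow> nat"
  assumes finite_letters: "finite A"
    and letters: "u \<in> W k \<Longrightarrow> set u \<subseteq> A"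
    and length_block: "u \<in> W k \<Longrightarrow> length u = l k"
    and l_pos: "0 < l k"
    and C_subset: "C k \<subseteq> W k"
    and C_nonempty: "C k \<noteq> {}"
    and W_Suc: "W (Suc k) = (\<lambda>(a, b). a @ (if ins k then v k else []) @ b) ` (W k \<times> C k)"
    and length_v: "length (v k) \<le> l k"
    and v_renewed: "ins k \<Longrightarrow> v (Suc k) \<in> W (Suc k)"
    and v_kept: "\<not> ins k \<Longrightarrow> v (Suc k) = v k"
begin

definition gap :: "nat \<Rightarrow> 'a list" where
  "gap k = (if ins k then v k else [])"

lemma W_Suc_gap: "W (Suc k) = (\<lambda>(a, b). a @ gap k @ b) ` (W k \<times> C k)"
  by (simp add: W_Suc gap_def)

lemma finite_W: "finite (W k)"
  by (rule finite_subset[OF _ finite_lists_length_eq[OF finite_letters, of "l k"]])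
     (use letters length_block in blast)

lemma finite_C: "finite (C k)"
  using finite_subset[OF C_subset finite_W] .

lemma card_W_Suc: "card (W (Suc k)) = card (W k) * card (C k)"
  unfolding W_Suc_gap by (rule card_joined_blocks) (rule length_block)

lemma extend_block:
  assumes "u \<in> W i" and "i \<le> j"
  shows "\<exists>z\<in>W j. prefix u z"
  using \<open>i \<le> j\<close>
proof (induction j rule: dec_induct)
  case base
  then show ?case using assms by blast
next
  case (step j)
  then obtain z where "z \<in> W j" "prefix u z" by blast
  moreover obtain b where "b \<in> C j" using C_nonempty by blast
  ultimately have "z @ gap j @ b \<in> W (Suc j)" "prefix u (z @ gap j @ b)"
    by (auto simp: W_Suc_gap)
  then show ?case by blast
qed

definition language :: "'a list set" where
  "language = {u. \<exists>k. \<exists>z\<in>W k. sublist u z}"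

definition blocks_shift :: "(nat \<Rightarrow> 'a) set" where
  "blocks_shift = {x. \<forall>u. occurs_in u x \<longrightarrow> u \<in> language}"

lemma language_sublist: "u \<in> language \<Longrightarrow> sublist w u \<Longrightarrow> w \<in> language"
  unfolding language_def using sublist_order.order_trans by blast

lemma language_late:
  assumes "u \<in> language"
  shows "\<exists>j\<ge>m. \<exists>z\<in>W j. sublist u z"
proof -
  obtain i z where z: "z \<in> W i" "sublist u z" using assms by (auto simp: language_def)
  obtain z' where "z' \<in> W (max i m)" "prefix z z'" using extend_block[OF z(1), of "max i m"] by auto
  then show ?thesis
    using z(2) by (meson max.cobounded2 prefix_imp_sublist sublist_order.order_trans)
qed

lemma letters_language: "u \<in> language \<Longrightarrow> set u \<subseteq> A"
  unfolding language_def using letters by (fastforce dest: set_mono_sublist)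

lemma blocks_shift_iff: "x \<in> blocks_shift \<longleftrightarrow> (\<forall>n. map x [0..<n] \<in> language)"
proof
  assume "x \<in> blocks_shift"
  moreover have "occurs_in (map x [0..<n]) x" for n by (rule sublist_imp_occurs_in[of _ x 0 n]) simp
  ultimately show "\<forall>n. map x [0..<n] \<in> language" by (simp add: blocks_shift_def)
next
  assume "\<forall>n. map x [0..<n] \<in> language"
  then show "x \<in> blocks_shift"
    unfolding blocks_shift_def by (auto elim!: occurs_in_imp_sublist_prefix intro: language_sublist)
qed

text \<open>Every block is a prefix of a block of the next stage, so a word of the language extends to a
  sequence in the subshift as the limit of a chain of prefixes.\<close>
lemma language_occurs:
  assumes "u \<in> language"
  shows "\<exists>x\<in>blocks_shift. occurs_in u x"
proof -
  obtain i z where z: "z \<in> W i" "sublist u z" using assms by (auto simp: language_def)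
  have "\<exists>b. \<forall>k. b k \<in> C k" using C_nonempty by (intro choice) blast
  then obtain b where b: "\<And>k. b k \<in> C k" by blast
  define E where "E = rec_nat z (\<lambda>n e. e @ gap (i + n) @ b (i + n))"
  have E0: "E 0 = z" and ES: "E (Suc n) = E n @ gap (i + n) @ b (i + n)" for n
    by (simp_all add: E_def)
  have EW: "E n \<in> W (i + n)" for n
  proof (induction n)
    case (Suc n)
    then have "E (Suc n) \<in> W (Suc (i + n))" using b[of "i + n"] unfolding W_Suc_gap ES by auto
    then show ?case by simp
  qed (simp add: E0 z)
  have len: "n \<le> length (E n)" for n
  proof (induction n)
    case (Suc n)
    have "length (b (i + n)) > 0" using b C_subset length_block l_pos by (metis subsetD)
    then show ?case using Suc unfolding ES length_append by linarith
  qed simp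
  have pre: "prefix (E n) (E m)" if "n \<le> m" for n m
    using that by (induction m rule: dec_induct) (auto simp: ES intro: prefix_order.order_trans)
  define x where "x j = E (Suc j) ! j" for j
  have x: "map x [0..<length (E n)] = E n" for n
  proof (rule nth_equalityI)
    fix j assume "j < length (map x [0..<length (E n)])"
    then have j: "j < length (E n)" by simp
    have j': "j < length (E (Suc j))" using len[of "Suc j"] by simp
    have "E (Suc j) ! j = E n ! j"
    proof (cases "n \<le> Suc j")
      case True
      then show ?thesis using pre[OF True] j by (auto simp: prefix_def nth_append)
    next
      case False
      then have "prefix (E (Suc j)) (E n)" by (intro pre) simp
      then show ?thesis using j' by (auto simp: prefix_def nth_append)
    qed
    then show "map x [0..<length (E n)] ! j = E n ! j" using j by (simp add: x_def)
  qed simp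
  have "map x [0..<n] \<in> language" for n
  proof -
    have "map x [0..<n] = take n (E n)"
      using x[of n] len[of n] by (metis take_map take_upt add_0)
    then have "sublist (map x [0..<n]) (E n)" by (simp add: take_is_prefix prefix_imp_sublist)
    then show ?thesis using EW by (auto simp: language_def)
  qed
  then have "x \<in> blocks_shift" by (simp add: blocks_shift_iff)
  moreover have "occurs_in u x"
    using z(2) x[of 0] E0 by (metis sublist_imp_occurs_in)
  ultimately show ?thesis by blast
qed

lemma blocks_shift_language:
  "{u. length u = n \<and> (\<exists>x\<in>blocks_shift. occurs_in u x)} = {u \<in> language. length u = n}"
  using language_occurs by (auto simp: blocks_shift_def)

lemma complexity_eq: "complexity blocks_shift n = card {u \<in> language. length u = n}"
  by (simp add: complexity_def blocks_shift_language)

lemma finite_language: "finite {u \<in> language. length u = n}"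
  by (rule finite_subset[OF _ finite_lists_length_eq[OF finite_letters, of n]])
     (use letters_language in blast)

lemma complexity_mono:
  assumes "n \<le> m"
  shows "complexity blocks_shift n \<le> complexity blocks_shift m"
proof -
  have "{u \<in> language. length u = n} \<subseteq> take n ` {u \<in> language. length u = m}"
  proof
    fix u assume "u \<in> {u \<in> language. length u = n}"
    then obtain x where x: "x \<in> blocks_shift" "occurs_in u x" and n: "length u = n"
      using language_occurs by blast
    then obtain i where i: "u = map x [i..<i + n]" by (auto simp: occurs_in_def)
    have "occurs_in (map x [i..<i + m]) x" by (rule sublist_imp_occurs_in[of _ x i "i + m"]) simp
    then have "map x [i..<i + m] \<in> {u \<in> language. length u = m}"
      using x(1) by (simp add: blocks_shift_def)
    moreover have "u = take n (map x [i..<i + m])"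
      using i assms by (simp add: take_map take_upt)
    ultimately show "u \<in> take n ` {u \<in> language. length u = m}" by blast
  qed
  then show ?thesis
    unfolding complexity_eq
    by (intro order_trans[OF card_mono card_image_le] finite_imageI finite_language)
qed

lemma complexity_ge: "card (W k) \<le> complexity blocks_shift (l k)"
  unfolding complexity_eq
  by (rule card_mono[OF finite_language]) (auto simp: language_def length_block)

text \<open>The junction inside a block of stage \<open>k + 1\<close> is a pair in \<open>W k \<times> C k\<close>. A block of stage
  \<open>k + 1\<close> ends in \<open>C k\<close> and begins in \<open>W k\<close>, so all junctions of later stages
  are pairs in \<open>C k \<times> W k\<close>.\<close>
definition adjacent :: "nat \<Rightarrow> ('a list \<times> 'a list) set" where
  "adjacent k = W k \<times> C k \<union> C k \<times> W k"

text \<open>\<open>chain k a b z\<close> describes a decomposition of \<open>z\<close> into blocks of stage \<open>k\<close>, the first being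
  \<open>a\<close> and the last \<open>b\<close>, with admissible neighbours and at most the word \<open>v k\<close> between
  two of them. The end blocks are recorded to control the pairs that arise on joining.\<close>
inductive chain :: "nat \<Rightarrow> 'a list \<Rightarrow> 'a list \<Rightarrow> 'a list \<Rightarrow> bool" for k where
  block: "a \<in> W k \<Longrightarrow> chain k a a a"
| join: "chain k a b x \<Longrightarrow> chain k c d y \<Longrightarrow> (b, c) \<in> adjacent k \<Longrightarrow> t \<in> {[], v k} \<Longrightarrow>
    chain k a d (x @ t @ y)"

text \<open>The only word inserted from stage \<open>k\<close> on that is not composed of blocks of stage \<open>k\<close> is the one
  waiting at stage \<open>k\<close>; this keeps the number of factors independent of later insertions.\<close>
lemma v_later: "k \<le> m \<Longrightarrow> v m = v k \<or> (\<exists>i. k < i \<and> i \<le> m \<and> v m \<in> W i)"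
proof (induction m rule: dec_induct)
  case (step m)
  show ?case
  proof (cases "ins m")
    case True
    then show ?thesis using v_renewed step.hyps(1) by (metis le_imp_less_Suc order_refl)
  next
    case False
    then show ?thesis using v_kept step.IH by (metis le_SucI)
  qed
qed simp

lemma block_chain:
  assumes "k < m" and "z \<in> W m"
  shows "\<exists>a\<in>W k. \<exists>b\<in>C k. chain k a b z"
  using assms
proof (induction m arbitrary: z rule: less_induct)
  case (less m)
  then obtain j where m: "m = Suc j" and "k \<le> j" by (cases m) auto
  obtain x y where xy: "x \<in> W j" "y \<in> C j" and z: "z = x @ gap j @ y"
    using less.prems(2) by (auto simp: m W_Suc_gap)
  show ?case
  proof (cases "k = j")
    case True
    have "chain k x y z" unfolding z
      using xy C_subset[of j] True by (intro chain.join) (auto simp: adjacent_def gap_def intro: chain.block)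
    then show ?thesis using xy True by blast
  next
    case False
    then have "k < j" using \<open>k \<le> j\<close> by simp
    have IH: "\<exists>a\<in>W k. \<exists>b\<in>C k. chain k a b w" if "w \<in> W i" "k < i" "i \<le> j" for w i
      using less.IH[of i w] that m by auto
    obtain a b where ab: "a \<in> W k" "b \<in> C k" "chain k a b x"
      using IH[OF xy(1) \<open>k < j\<close>] by auto
    obtain c d where cd: "c \<in> W k" "d \<in> C k" "chain k c d y"
      using IH[of y j] xy(2) C_subset \<open>k < j\<close> by blast
    have "chain k a d z"
    proof (cases "gap j \<in> {[], v k}")
      case True
      then show ?thesis unfolding z using ab cd by (intro chain.join[OF ab(3) cd(3)]) (auto simp: adjacent_def)
    next
      case False
      \<comment> \<open>The inserted word was chosen after stage \<open>k\<close>, so it is a chain itself and splits the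
        junction into two, both with a last block in \<open>C k\<close> on the left.\<close>
      then have "gap j = v j" and "v j \<noteq> v k" by (auto simp: gap_def split: if_splits)
      then obtain i where "k < i" "i \<le> j" "gap j \<in> W i"
        using v_later[OF \<open>k \<le> j\<close>] by auto
      then obtain e g where eg: "e \<in> W k" "g \<in> C k" "chain k e g (gap j)"
        using IH by blast
      have "chain k a g (x @ [] @ gap j)"
        using ab eg by (intro chain.join[OF ab(3) eg(3)]) (auto simp: adjacent_def)
      then have "chain k a d ((x @ [] @ gap j) @ [] @ y)"
        using cd eg by (intro chain.join[OF _ cd(3)]) (auto simp: adjacent_def)
      then show ?thesis by (simp add: z)
    qed
    then show ?thesis using ab cd by blast
  qed
qed

lemma chain_ends: "chain k a b z \<Longrightarrow> prefix a z \<and> suffix b z \<and> a \<in> W k \<and> b \<in> W k"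
proof (induction rule: chain.induct)
  case (join a b x c d y t)
  then show ?case by (auto intro: suffix_appendI prefix_order.order_trans[OF _ prefixI[OF refl]])
qed auto

lemma chain_factor:
  assumes "chain k a b z" and "sublist u z"
  shows "(\<exists>w\<in>W k. sublist w u) \<or> (\<exists>w\<in>W k. sublist u w) \<or>
    (\<exists>(b, c)\<in>adjacent k. \<exists>t\<in>{[], v k}. sublist u (b @ t @ c))"
  using assms
proof (induction rule: chain.induct)
  case (block a)
  then show ?case by blast
next
  case (join a b x c d y t)
  obtain x' y' where xy: "x = x' @ b" "y = c @ y'"
    using chain_ends[OF join.hyps(1)] chain_ends[OF join.hyps(2)] by (auto simp: prefix_def suffix_def)
  have "sublist u (x' @ b @ t @ c @ y')" using join.prems xy by simp
  from sublist_across_gap[OF this] consider "sublist u x" | "sublist u y" | "sublist b u"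
    | "sublist c u" | "sublist u (b @ t @ c)"
    using xy by blast
  then show ?case
  proof cases
    case 3
    then show ?thesis using chain_ends[OF join.hyps(1)] by blast
  next
    case 4
    then show ?thesis using chain_ends[OF join.hyps(2)] by blast
  next
    case 5
    then show ?thesis using join.hyps by blast
  qed (use join.IH in blast)+
qed

lemma language_factor:
  assumes "u \<in> language"
  shows "(\<exists>w\<in>W k. sublist w u) \<or>
    (\<exists>(b, c)\<in>adjacent k. \<exists>t\<in>{[], v k}. sublist u (b @ t @ c))"
proof -
  obtain j z where "j \<ge> Suc k" "z \<in> W j" "sublist u z"
    using language_late[OF assms] by blast
  then obtain a b where "chain k a b z" using block_chain[of k j z] by auto
  moreover have "\<exists>(b, c)\<in>adjacent k. \<exists>t\<in>{[], v k}. sublist u (b @ t @ c)"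
    if w: "w \<in> W k" "sublist u w" for w
  proof -
    obtain c where "c \<in> C k" using C_nonempty by blast
    then have "(w, c) \<in> adjacent k" using w by (simp add: adjacent_def)
    moreover have "sublist u (w @ [] @ c)"
      using w(2) by (simp add: sublist_append)
    ultimately show ?thesis by blast
  qed
  ultimately show ?thesis using chain_factor \<open>sublist u z\<close> by blast
qed

lemma length_adjacent:
  assumes "(b, c) \<in> adjacent k" "t \<in> {[], v k}"
  shows "length (b @ t @ c) \<le> 3 * l k"
  using assms C_subset[of k] length_v[of k] by (auto simp: adjacent_def length_block subset_iff)

text \<open>A factor is determined by a pair of neighbours, by whether \<open>v k\<close> lies between them, and by its
  starting position in the resulting word, whose length is at most \<open>3 * l k\<close>. The cardinality of
  \<open>adjacent k\<close> is where \<open>card (W k) * card (C k) = card (W (Suc k))\<close> replaces the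
  useless bound \<open>card (W k) * card (W k)\<close>.\<close>
lemma complexity_le:
  assumes "n \<le> l k"
  shows "complexity blocks_shift n \<le> 4 * card (W (Suc k)) * (3 * l k + 1)"
proof -
  define F :: "('a list \<times> 'a list) \<times> 'a list \<times> nat \<Rightarrow> 'a list"
    where "F = (\<lambda>((b, c), t, p). take n (drop p (b @ t @ c)))"
  have "{u \<in> language. length u = n} \<subseteq> F ` (adjacent k \<times> {[], v k} \<times> {..3 * l k})"
  proof
    fix u assume u: "u \<in> {u \<in> language. length u = n}"
    have "\<exists>(b, c)\<in>adjacent k. \<exists>t\<in>{[], v k}. sublist u (b @ t @ c)"
    proof (cases "\<exists>w\<in>W k. sublist w u")
      case True
      then obtain w where w: "w \<in> W k" "sublist w u" by blast
      then have "length w = length u" using u assms sublist_length_le[OF w(2)] length_block by auto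
      then have "w = u" using w(2) by (auto simp: sublist_def)
      obtain c where "c \<in> C k" using C_nonempty by blast
      then have "(w, c) \<in> adjacent k" using w by (simp add: adjacent_def)
      moreover have "sublist u (w @ [] @ c)" using \<open>w = u\<close> by simp
      ultimately show ?thesis by blast
    next
      case False
      then show ?thesis using language_factor u by blast
    qed
    then obtain b c t where bc: "(b, c) \<in> adjacent k" and t: "t \<in> {[], v k}"
      and "sublist u (b @ t @ c)" by blast
    then obtain p q where pq: "b @ t @ c = p @ u @ q" by (auto simp: sublist_def)
    have "length p \<le> 3 * l k"
      using length_adjacent[OF bc t] unfolding pq by simp
    moreover have "u = F ((b, c), t, length p)" unfolding F_def prod.case pq using u by simp
    ultimately show "u \<in> F ` (adjacent k \<times> {[], v k} \<times> {..3 * l k})" using bc t by blast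
  qed
  moreover have "finite (adjacent k)" by (simp add: adjacent_def finite_W finite_C)
  ultimately have "complexity blocks_shift n \<le> card (adjacent k \<times> {[], v k} \<times> {..3 * l k})"
    unfolding complexity_eq by (intro surj_card_le) auto
  also have "\<dots> = card (adjacent k) * (card {[], v k} * (3 * l k + 1))"
    by (simp add: card_cartesian_product)
  also have "\<dots> \<le> (card (W (Suc k)) + card (W (Suc k))) * (2 * (3 * l k + 1))"
  proof (intro mult_mono)
    show "card (adjacent k) \<le> card (W (Suc k)) + card (W (Suc k))"
      unfolding adjacent_def card_W_Suc
      by (rule order_trans[OF card_Un_le]) (simp add: card_cartesian_product)
    show "card {[], v k} \<le> 2" by (simp add: card_insert_if)
  qed simp_all
  finally show ?thesis by (simp add: algebra_simps)
qed

lemma long_factor_contains_block: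
  assumes "u \<in> language" and "length u > 3 * l k"
  shows "\<exists>w\<in>W k. sublist w u"
proof (rule ccontr)
  assume "\<not> ?thesis"
  then obtain b c t where "(b, c) \<in> adjacent k" "t \<in> {[], v k}" and u: "sublist u (b @ t @ c)"
    using language_factor[OF assms(1), of k] by blast
  then show False
    using length_adjacent[of b c k t] sublist_length_le[OF u] assms(2) by linarith
qed

lemma subshift_blocks_shift: "subshift A blocks_shift"
  unfolding subshift_def closedin_sequences_iff
proof (intro conjI allI impI)
  have "W 0 \<noteq> {}" using C_subset C_nonempty by blast
  then have "[] \<in> language" by (auto simp: language_def)
  then show "blocks_shift \<noteq> {}" using language_occurs by blast
  show "blocks_shift \<subseteq> {x. \<forall>i. x i \<in> A}"
  proof (intro subsetI CollectI allI)
    fix x i assume "x \<in> blocks_shift"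
    then have "set (map x [0..<Suc i]) \<subseteq> A" using blocks_shift_iff letters_language by blast
    then show "x i \<in> A" by auto
  qed
  show "x \<in> blocks_shift" if lim: "\<forall>n. \<exists>y\<in>blocks_shift. \<forall>i<n. y i = x i" for x
    unfolding blocks_shift_iff
  proof
    fix n
    obtain y where "y \<in> blocks_shift" "\<forall>i<n. y i = x i" using lim by blast
    moreover from this have "map x [0..<n] = map y [0..<n]" by simp
    ultimately show "map x [0..<n] \<in> language" by (metis blocks_shift_iff)
  qed
  show "shift ` blocks_shift \<subseteq> blocks_shift"
  proof
    fix y assume "y \<in> shift ` blocks_shift"
    then obtain x where x: "x \<in> blocks_shift" and y: "y = shift x" by blast
    have "occurs_in u x" if occ: "occurs_in u y" for u
    proof -
      obtain i where "u = map y [i..<i + length u]" using occ unfolding occurs_in_def by blast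
      moreover have "map y [i..<i + length u] = map x [Suc i..<Suc i + length u]"
        by (auto intro!: nth_equalityI simp: y shift_def simp del: upt_Suc)
      ultimately show ?thesis unfolding occurs_in_def by metis
    qed
    then show "y \<in> blocks_shift" using x by (auto simp: blocks_shift_def)
  qed
qed

end

text \<open>An inserted word occurs in every block of the next stage, so the additional
  assumption makes every factor unavoidable in long factors.\<close>
locale recurrent_block_system = block_system +
  assumes inserted: "u \<in> W i \<Longrightarrow> \<exists>k. ins k \<and> sublist u (v k)"
begin

lemma eventually_in_all_blocks:
  assumes "u \<in> language"
  shows "\<exists>m. \<forall>w\<in>W m. sublist u w"
proof -
  obtain i z where z: "z \<in> W i" "sublist u z" using assms by (auto simp: language_def)
  obtain k where k: "ins k" "sublist z (v k)" using inserted[OF z(1)] by blast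
  have "sublist u w" if "w \<in> W (Suc k)" for w
  proof -
    have "sublist (v k) w" using that k(1) by (auto simp: W_Suc)
    then show ?thesis using z(2) k(2) sublist_order.order_trans by blast
  qed
  then show ?thesis by blast
qed

lemma minimal_blocks_shift: "minimal_subshift A blocks_shift"
  unfolding minimal_subshift_def
proof (intro conjI notI subshift_blocks_shift)
  assume "\<exists>Y. subshift A Y \<and> Y \<subset> blocks_shift"
  then obtain Y where Y: "subshift A Y" "Y \<subseteq> blocks_shift" "\<not> blocks_shift \<subseteq> Y" by blast
  have "x \<in> Y" if x: "x \<in> blocks_shift" for x
  proof -
    obtain y where y: "y \<in> Y" using Y(1) by (auto simp: subshift_def)
    have "\<exists>y'\<in>Y. \<forall>i<n. y' i = x i" for n
    proof -
      have "map x [0..<n] \<in> language" using x by (simp add: blocks_shift_iff)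
      then obtain m where m: "\<forall>w\<in>W m. sublist (map x [0..<n]) w"
        using eventually_in_all_blocks by blast
      let ?p = "map y [0..<3 * l m + 1]"
      have "?p \<in> language" using y Y(2) blocks_shift_iff by blast
      then obtain w where "w \<in> W m" "sublist w ?p"
        using long_factor_contains_block[of ?p m] by auto
      then have "sublist (map x [0..<n]) ?p" using m sublist_order.order_trans by blast
      then obtain j where j: "map x [0..<n] = map y [j..<j + n]"
        using sublist_imp_occurs_in by (fastforce simp: occurs_in_def)
      have "y (j + i) = x i" if "i < n" for i
        using arg_cong[OF j, of "\<lambda>s. s ! i"] that by simp
      then show ?thesis
        by (intro bexI[OF _ subshift_tail[OF Y(1) y, of j]]) simp
    qed
    moreover have "\<forall>i. x i \<in> A"
      using subshift_blocks_shift x by (auto simp: subshift_def closedin_sequences_iff)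
    ultimately show ?thesis
      using Y(1) by (auto simp: subshift_def closedin_sequences_iff)
  qed
  then show False using Y(3) by blast
qed

end

section \<open>Blocks with a prescribed rate of growth\<close>

text \<open>The least \<open>c\<close> with \<open>F' \<le> w * c\<close> works: it is at most \<open>w\<close> because \<open>F' \<le> F * F \<le> w * w\<close>, and
  rounding up loses at most a factor of two, which does not accumulate from stage to stage because
  \<open>c\<close> is chosen from the actual size \<open>w\<close>. Only for \<open>c = 1\<close> does the upper bound on \<open>w\<close> matter.\<close>
lemma branching_number:
  fixes F F' w :: nat
  assumes "0 < F" "F \<le> F'" "F' \<le> F * F" and w: "F \<le> w" "w \<le> 2 * F"
  obtains c where "0 < c" "c \<le> w" "F' \<le> w * c" "w * c \<le> 2 * F'"
proof -
  define P where "P c \<longleftrightarrow> 0 < c \<and> F' \<le> w * c" for c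
  define c where "c = (LEAST c. P c)"
  have "F * F \<le> w * w" using w by (intro mult_mono) simp_all
  then have "P w" using assms by (simp add: P_def)
  then have "P c" "c \<le> w" unfolding c_def by (rule LeastI, rule Least_le)
  have "w * c \<le> 2 * F'"
  proof (cases "c = 1")
    case True
    then show ?thesis using w \<open>F \<le> F'\<close> by simp
  next
    case False
    then obtain d where d: "c = Suc d" "0 < d" using \<open>P c\<close> by (cases c) (auto simp: P_def)
    have "\<not> P d" using d not_less_Least[of d P] by (simp add: c_def)
    then have "w * d < F'" using d by (simp add: P_def)
    moreover have "w \<le> w * d" using d by simp
    moreover have "w * c = w + w * d" using d by simp
    ultimately show ?thesis by linarith
  qed
  then show ?thesis using that \<open>P c\<close> \<open>c \<le> w\<close> by (auto simp: P_def)
qed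

text \<open>Here \<open>r\<close> counts the insertions made so far. The last condition is
  \<open>l \<le> (2 - 1 / 2 ^ r) * 2 ^ k\<close> without division: the insertion that raises \<open>r\<close> to \<open>r + 1\<close> may increase
  the ratio \<open>l / 2 ^ k\<close> by \<open>1 / 2 ^ (r + 1)\<close>, so the ratio stays below two forever. The bounds on
  \<open>card W * card C\<close> are those for the number of blocks of the next stage.\<close>
definition valid_stage ::
    "(nat \<Rightarrow> nat) \<Rightarrow> 'a set \<Rightarrow> nat \<Rightarrow> 'a list set \<Rightarrow> 'a list set \<Rightarrow> 'a list \<Rightarrow> nat \<Rightarrow> nat \<Rightarrow> bool" where
  "valid_stage F A k W C v r l \<longleftrightarrow>
    (\<forall>u\<in>W. set u \<subseteq> A \<and> length u = l) \<and> set v \<subseteq> A \<and> C \<subseteq> W \<and> C \<noteq> {} \<and>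
    F k \<le> card W \<and> card W \<le> 2 * F k \<and>
    F (Suc k) \<le> card W * card C \<and> card W * card C \<le> 2 * F (Suc k) \<and>
    length v \<le> l \<and> 2 ^ k \<le> l \<and> 2 ^ r * l + 2 ^ k \<le> 2 * 2 ^ r * 2 ^ k"

definition ready :: "nat \<Rightarrow> 'a list \<Rightarrow> nat \<Rightarrow> bool" where
  "ready k v r \<longleftrightarrow> 2 ^ r * length v \<le> 2 ^ k"

text \<open>Decoding \<open>r\<close> as a pair and taking only its first component yields an enumeration of all words
  in which each word recurs infinitely often. A word may therefore be skipped when no block
  contains it yet.\<close>
definition next_stage :: "nat \<Rightarrow> 'a::countable list set \<Rightarrow> 'a list set \<Rightarrow> 'a list \<Rightarrow> nat \<Rightarrow>
    'a list set \<Rightarrow> 'a list \<Rightarrow> nat \<Rightarrow> bool" where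
  "next_stage k W C v r W' v' r' \<longleftrightarrow>
    W' = (\<lambda>(a, b). a @ (if ready k v r then v else []) @ b) ` (W \<times> C) \<and>
    (if ready k v r
     then r' = Suc r \<and> v' \<in> W' \<and>
       (let t = from_nat (fst (prod_decode r)) in (\<exists>z\<in>W'. sublist t z) \<longrightarrow> sublist t v')
     else r' = r \<and> v' = v)"

lemma choose_branches:
  fixes F :: "nat \<Rightarrow> nat"
  assumes F: "\<And>k. 0 < F k" "\<And>k. F k \<le> F (Suc k)" "\<And>k. F (Suc k) \<le> F k * F k"
    and W: "F k \<le> card W" "card W \<le> 2 * F k"
  obtains C where "C \<subseteq> W" "C \<noteq> {}" "F (Suc k) \<le> card W * card C" "card W * card C \<le> 2 * F (Suc k)"
proof -
  obtain c where c: "0 < c" "c \<le> card W" "F (Suc k) \<le> card W * c" "card W * c \<le> 2 * F (Suc k)"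
    using branching_number[OF F W] by blast
  obtain C where "C \<subseteq> W" "card C = c" using c(2) by (rule obtain_subset_with_card_n)
  then show ?thesis using c by (intro that[of C]) auto
qed

lemma valid_stage_0:
  fixes F :: "nat \<Rightarrow> nat"
  assumes F: "\<And>k. 0 < F k" "\<And>k. F k \<le> F (Suc k)" "\<And>k. F (Suc k) \<le> F k * F k"
  shows "\<exists>W C v r l. valid_stage F {..<F 0} 0 W C v r l"
proof -
  let ?W = "(\<lambda>a. [a]) ` {..<F 0}"
  have card: "card ?W = F 0" by (simp add: card_image inj_on_def)
  obtain C where "C \<subseteq> ?W" "C \<noteq> {}" "F (Suc 0) \<le> card ?W * card C" "card ?W * card C \<le> 2 * F (Suc 0)"
    using choose_branches[of F 0 ?W] F card by auto
  then have "valid_stage F {..<F 0} 0 ?W C [] 0 1"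
    using card by (auto simp: valid_stage_def)
  then show ?thesis by blast
qed

lemma valid_stage_Suc:
  fixes F :: "nat \<Rightarrow> nat" and W :: "'a::countable list set"
  assumes F: "\<And>k. 0 < F k" "\<And>k. F k \<le> F (Suc k)" "\<And>k. F (Suc k) \<le> F k * F k"
    and valid: "valid_stage F A k W C v r l"
  shows "\<exists>W' C' v' r' l'. valid_stage F A (Suc k) W' C' v' r' l' \<and> next_stage k W C v r W' v' r'"
proof -
  define g where "g = (if ready k v r then v else [])"
  define W' where "W' = (\<lambda>(a, b). a @ g @ b) ` (W \<times> C)"
  define l' where "l' = 2 * l + length g"
  define r' where "r' = (if ready k v r then Suc r else r)"
  define t :: "'a list" where "t = from_nat (fst (prod_decode r))"
  have W: "\<And>u. u \<in> W \<Longrightarrow> set u \<subseteq> A" "set v \<subseteq> A" "\<And>u. u \<in> W \<Longrightarrow> length u = l" "C \<subseteq> W" "C \<noteq> {}"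
    "F (Suc k) \<le> card W * card C" "card W * card C \<le> 2 * F (Suc k)"
    "length v \<le> l" "2 ^ k \<le> l" "2 ^ r * l + 2 ^ k \<le> 2 * 2 ^ r * 2 ^ k"
    using valid by (auto simp: valid_stage_def)
  have card: "card W' = card W * card C"
    unfolding W'_def using W(3) by (rule card_joined_blocks)
  have len: "length u = l'" if "u \<in> W'" for u
    using that W(3,4) by (auto simp: W'_def l'_def subset_iff)
  have letters: "set u \<subseteq> A" if u: "u \<in> W'" for u
  proof -
    obtain a b where "a \<in> W" "b \<in> C" "u = a @ g @ b" using u by (auto simp: W'_def)
    then show ?thesis using W(1)[of a] W(1)[of b] W(2,4) by (auto simp: g_def)
  qed
  have "W' \<noteq> {}" using W(4,5) by (auto simp: W'_def)
  obtain C' where C': "C' \<subseteq> W'" "C' \<noteq> {}" "F (Suc (Suc k)) \<le> card W' * card C'"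
    "card W' * card C' \<le> 2 * F (Suc (Suc k))"
    using choose_branches[of F "Suc k" W'] F card W(6,7) by auto
  have "\<exists>v'\<in>W'. (\<exists>z\<in>W'. sublist t z) \<longrightarrow> sublist t v'"
    using \<open>W' \<noteq> {}\<close> by blast
  then obtain p where p: "p \<in> W'" "(\<exists>z\<in>W'. sublist t z) \<longrightarrow> sublist t p" by blast
  define v' where "v' = (if ready k v r then p else v)"
  have "2 ^ r' * l' + 2 ^ Suc k \<le> 2 * 2 ^ r' * 2 ^ Suc k"
  proof (cases "ready k v r")
    case True
    then have "2 ^ r * length v \<le> 2 ^ k" by (simp add: ready_def)
    moreover have "2 ^ r' * l' + 2 ^ Suc k = 4 * (2 ^ r * l) + 2 * (2 ^ r * length v) + 2 * 2 ^ k"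
      using True by (simp add: r'_def l'_def g_def algebra_simps)
    moreover have "2 * 2 ^ r' * 2 ^ Suc k = 4 * (2 * 2 ^ r * (2::nat) ^ k)"
      using True by (simp add: r'_def algebra_simps)
    ultimately show ?thesis using W(10) by linarith
  next
    case False
    have "2 ^ r' * l' + 2 ^ Suc k = 2 * (2 ^ r * l + 2 ^ k)"
      using False by (simp add: r'_def l'_def g_def algebra_simps)
    then show ?thesis using False W(10) by (simp add: r'_def)
  qed
  moreover have "2 ^ Suc k \<le> l'" using W(9) by (simp add: l'_def)
  moreover have "length v' \<le> l'" using len[OF p(1)] W(8) by (simp add: v'_def l'_def)
  moreover have "set v' \<subseteq> A" using letters[OF p(1)] W(2) by (simp add: v'_def)
  ultimately have "valid_stage F A (Suc k) W' C' v' r' l'"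
    unfolding valid_stage_def using letters len C' card W(6,7) by auto
  moreover have "next_stage k W C v r W' v' r'"
    unfolding next_stage_def Let_def v'_def r'_def
      t_def[symmetric] g_def[symmetric] W'_def[symmetric]
    using p by simp
  ultimately show ?thesis by blast
qed

text \<open>Insertions never stop, since a waiting word has a fixed length while the blocks grow. The counter
  \<open>r\<close> hence attains all large values, among them one that decodes to a given block \<open>u\<close>, at a time
  when \<open>u\<close> is a prefix of some current block; then the next waiting word contains \<open>u\<close>.\<close>
lemma recurrent_block_system_exists:
  fixes F :: "nat \<Rightarrow> nat"
  assumes F: "\<And>k. 0 < F k" "\<And>k. F k \<le> F (Suc k)" "\<And>k. F (Suc k) \<le> F k * F k"
  shows "\<exists>W C v ins l. recurrent_block_system {..<F 0} W C v ins l \<and>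
    (\<forall>k. F k \<le> card (W k) \<and> card (W k) \<le> 2 * F k \<and> 2 ^ k \<le> l k \<and> l k \<le> 2 * 2 ^ k)"
proof -
  let ?valid = "\<lambda>k (W, C, v, r, l). valid_stage F {..<F 0} k W C v r l"
  let ?next = "\<lambda>k (W, C, v, r, l) (W', C', v', r', l'). next_stage k W C v r W' v' r'"
  have "\<exists>S. \<forall>k. ?valid k (S k) \<and> ?next k (S k) (S (Suc k))"
  proof (rule dependent_nat_choice)
    show "\<exists>s. ?valid 0 s" using valid_stage_0[of F] F by simp
    show "\<exists>s'. ?valid (Suc k) s' \<and> ?next k s s'" if "?valid k s" for s k
      using valid_stage_Suc[of F, OF F] that by (cases s) simp
  qed
  then obtain S where S: "\<And>k. ?valid k (S k) \<and> ?next k (S k) (S (Suc k))" by blast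
  define W where "W k = fst (S k)" for k
  define C where "C k = fst (snd (S k))" for k
  define v where "v k = fst (snd (snd (S k)))" for k
  define r where "r k = fst (snd (snd (snd (S k))))" for k
  define l where "l k = snd (snd (snd (snd (S k))))" for k
  define ins where "ins k = ready k (v k) (r k)" for k
  have valid: "valid_stage F {..<F 0} k (W k) (C k) (v k) (r k) (l k)"
    and nxt: "next_stage k (W k) (C k) (v k) (r k) (W (Suc k)) (v (Suc k)) (r (Suc k))" for k
    using S[of k] by (simp_all add: W_def C_def v_def r_def l_def case_prod_unfold)
  have bounds: "F k \<le> card (W k) \<and> card (W k) \<le> 2 * F k \<and> 2 ^ k \<le> l k \<and> l k \<le> 2 * 2 ^ k" for k
  proof -
    have "2 ^ r k * l k + 2 ^ k \<le> 2 * 2 ^ r k * 2 ^ k"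
      using valid[of k] unfolding valid_stage_def by blast
    moreover have "2 * 2 ^ r k * 2 ^ k = 2 ^ r k * (2 * (2::nat) ^ k)" by simp
    ultimately have "2 ^ r k * l k \<le> 2 ^ r k * (2 * 2 ^ k)" by linarith
    then have "l k \<le> 2 * 2 ^ k" by (simp only: mult_le_cancel1) simp
    then show ?thesis using valid[of k] by (simp add: valid_stage_def)
  qed
  interpret block_system "{..<F 0}" W C v ins l
  proof
    fix k u
    show "set u \<subseteq> {..<F 0}" "length u = l k" if "u \<in> W k"
      using valid[of k] that by (auto simp: valid_stage_def)
    show "0 < l k" using bounds[of k] by (metis less_le_trans zero_less_numeral zero_less_power)
    show "C k \<subseteq> W k" "C k \<noteq> {}" "length (v k) \<le> l k"
      using valid[of k] by (auto simp: valid_stage_def)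
    show "W (Suc k) = (\<lambda>(a, b). a @ (if ins k then v k else []) @ b) ` (W k \<times> C k)"
      using nxt[of k] unfolding next_stage_def ins_def by blast
    show "v (Suc k) \<in> W (Suc k)" if "ins k"
      using nxt[of k] that unfolding next_stage_def ins_def by (simp only: if_True) blast
    show "v (Suc k) = v k" if "\<not> ins k"
      using nxt[of k] that unfolding next_stage_def ins_def by simp
  qed simp
  have r_Suc: "r (Suc k) = (if ins k then Suc (r k) else r k)" for k
    using nxt[of k] by (simp add: next_stage_def ins_def)
  \<comment> \<open>the waiting word stays the same until it is inserted\<close>
  have next_ins: "\<exists>k'\<ge>k. ins k' \<and> r k' = r k \<and> v k' = v k" for k
  proof (rule ccontr)
    assume no: "\<not> ?thesis"
    have const: "r m = r k \<and> v m = v k" if "k \<le> m" for m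
      using that
    proof (induction m rule: dec_induct)
      case (step m)
      then have "\<not> ins m" using no by blast
      then show ?case using step r_Suc v_kept by simp
    qed simp
    define m where "m = max k (2 ^ r k * length (v k))"
    have "2 ^ r k * length (v k) \<le> m" by (simp add: m_def)
    then have "2 ^ r k * length (v k) \<le> 2 ^ m" using less_exp[of m] by linarith
    moreover have "k \<le> m" by (simp add: m_def)
    ultimately have "ins m" using const[of m] by (simp add: ins_def ready_def)
    then show False using no const \<open>k \<le> m\<close> by blast
  qed
  have r_attains: "\<exists>k\<ge>i. r k = r i + d" for i d
  proof (induction d)
    case (Suc d)
    then obtain k where "k \<ge> i" "r k = r i + d" by blast
    moreover obtain k' where "k' \<ge> k" "ins k'" "r k' = r k" using next_ins by blast
    ultimately have "Suc k' \<ge> i" "r (Suc k') = r i + Suc d" using r_Suc by simp_all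
    then show ?case by blast
  qed auto
  have "recurrent_block_system {..<F 0} W C v ins l"
  proof unfold_locales
    fix u i assume u: "u \<in> W i"
    \<comment> \<open>The second component makes the code at least \<open>r i\<close>, so that it is reached after stage \<open>i\<close>.\<close>
    define R where "R = prod_encode (to_nat u, r i)"
    have "r i \<le> R" unfolding R_def by (rule le_prod_encode_2)
    then obtain k where k: "i \<le> k" "r k = R" using r_attains[of i "R - r i"] by auto
    obtain k' where k': "k \<le> k'" "ins k'" "r k' = R" using next_ins[of k] k(2) by auto
    have "\<exists>z\<in>W (Suc k'). sublist u z"
      using extend_block[OF u, of "Suc k'"] k(1) k'(1) by (auto dest: prefix_imp_sublist)
    then have "sublist u (v (Suc k'))"
      using nxt[of k'] k'(2,3) by (simp add: next_stage_def Let_def ins_def R_def)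
    then show "\<exists>k. ins k \<and> sublist u (v k)" using next_ins[of "Suc k'"] by metis
  qed
  then show ?thesis using bounds by blast
qed

section \<open>Comparison at powers of two\<close>

text \<open>A zero at \<open>n\<close> forces zeros at all later arguments, so \<open>f\<close> would be bounded.\<close>
lemma submultiplicative_pos:
  assumes "submultiplicative f" and "\<not> bdd_above (range f)"
  shows "0 < f n"
proof (rule ccontr)
  assume "\<not> 0 < f n"
  have "f m \<le> Max (f ` {..n})" for m
  proof (cases "m \<le> n")
    case False
    then have "f m \<le> f n * f (m - n)"
      using assms(1) unfolding submultiplicative_def by (metis le_add_diff_inverse nat_le_linear)
    then show ?thesis using \<open>\<not> 0 < f n\<close> by simp
  qed simp
  then have "bdd_above (range f)" by (intro bdd_aboveI2[of UNIV f])
  then show False using assms(2) by blast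
qed

lemma power_of_two_above:
  assumes "1 \<le> (n::nat)"
  obtains k where "n \<le> 2 ^ k" "2 ^ k \<le> 2 * n"
proof (cases "n = 1")
  case True
  then show ?thesis using that[of 0] by simp
next
  case False
  define k where "k = (LEAST k. n \<le> 2 ^ k)"
  have "n \<le> 2 ^ n" using less_exp[of n] by simp
  then have k: "n \<le> 2 ^ k" unfolding k_def by (rule LeastI)
  with False assms obtain j where j: "k = Suc j" by (cases k) auto
  have "\<not> n \<le> 2 ^ j" using not_less_Least[of j "\<lambda>k. n \<le> 2 ^ k"] j by (simp add: k_def)
  then show ?thesis using that[OF k] j by simp
qed

theorem proposition1p2:
  fixes f :: "nat \<Rightarrow> nat"
  assumes "mono f"
    and "\<not> bdd_above (range f)"
    and "submultiplicative f"
  shows "\<exists>(A :: nat set) X. finite A \<and> minimal_subshift A X \<and>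
           f \<preceq> complexity X \<and> complexity X \<preceq> (\<lambda>n. n * f n)"
proof -
  note mono = monoD[OF \<open>mono f\<close>] and pos = submultiplicative_pos[OF assms(3,2)]
  define F where "F k = f (2 ^ k)" for k
  have F: "0 < F k" "F k \<le> F (Suc k)" "F (Suc k) \<le> F k * F k" for k
  proof -
    show "0 < F k" using pos by (simp add: F_def)
    show "F k \<le> F (Suc k)" unfolding F_def by (rule mono) simp
    have "f (2 ^ k + 2 ^ k) \<le> f (2 ^ k) * f (2 ^ k)"
      using assms(3) unfolding submultiplicative_def by blast
    then show "F (Suc k) \<le> F k * F k" by (simp add: F_def mult_2)
  qed
  obtain W C v ins l where sys: "recurrent_block_system {..<F 0} W C v ins l"
    and W: "\<And>k. F k \<le> card (W k)" "\<And>k. card (W k) \<le> 2 * F k"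
    and l: "\<And>k. 2 ^ k \<le> l k" "\<And>k. l k \<le> 2 * 2 ^ k"
    using recurrent_block_system_exists[of F] F by metis
  interpret recurrent_block_system "{..<F 0}" W C v ins l by (rule sys)
  have lower: "f n \<le> complexity blocks_shift (4 * n)" if "1 \<le> n" for n
  proof -
    obtain k where k: "n \<le> 2 ^ k" "2 ^ k \<le> 2 * n" using \<open>1 \<le> n\<close> by (rule power_of_two_above)
    have "f n \<le> F k" unfolding F_def using k(1) by (rule mono)
    also have "\<dots> \<le> card (W k)" by (rule W)
    also have "\<dots> \<le> complexity blocks_shift (l k)" by (rule complexity_ge)
    also have "\<dots> \<le> complexity blocks_shift (4 * n)"
      using l(2)[of k] k(2) by (intro complexity_mono) linarith
    finally show ?thesis .
  qed
  have upper: "complexity blocks_shift n \<le> 28 * (4 * n * f (4 * n))" if "1 \<le> n" for n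
  proof -
    obtain k where k: "n \<le> 2 ^ k" "2 ^ k \<le> 2 * n" using \<open>1 \<le> n\<close> by (rule power_of_two_above)
    have "complexity blocks_shift n \<le> 4 * card (W (Suc k)) * (3 * l k + 1)"
      using k(1) l(1)[of k] by (intro complexity_le) linarith
    also have "\<dots> \<le> 4 * (2 * f (4 * n)) * (14 * n)"
    proof (intro mult_mono)
      have "card (W (Suc k)) \<le> 2 * F (Suc k)" by (rule W)
      moreover have "F (Suc k) \<le> f (4 * n)" unfolding F_def using k(2) by (intro mono) simp
      ultimately show "card (W (Suc k)) \<le> 2 * f (4 * n)" by linarith
      show "3 * l k + 1 \<le> 14 * n" using l(2)[of k] k \<open>1 \<le> n\<close> by linarith
    qed simp_all
    finally show ?thesis by (simp add: algebra_simps)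
  qed
  show ?thesis
  proof (intro exI conjI)
    show "finite {..<F 0}" by simp
    show "minimal_subshift {..<F 0} blocks_shift" by (rule minimal_blocks_shift)
    show "f \<preceq> complexity blocks_shift"
      unfolding dominated_def using lower by (intro exI[of _ 1] exI[of _ 4]) simp
    have "real (complexity blocks_shift n) \<le> 28 * real (4 * n * f (4 * n))" if "1 \<le> n" for n
      using of_nat_mono[OF upper[OF that], where ?'a = real] by simp
    then show "complexity blocks_shift \<preceq> (\<lambda>n. n * f n)"
      unfolding dominated_def by (intro exI[of _ 28] exI[of _ 4]) simp
  qed
qed

end
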